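(* For $\mathbf w=(w_1,w_2,\ldots)\in(0,1)^{\{1,2,\ldots\}}$ let $p_i(\mathbf w):=(1-w_1)\cdots(1-w_{i-1})w_i$. Then for each integer $k\ge1$, the expression $$\sum_{\pi\in\mathfrak S_k}\int_{(0,1)^k}p_{\pi(1)}(\mathbf w)\prod_{i=2}^k\frac{p_{\pi(i)}(\mathbf w)}{1-\sum_{j=1}^{i-1}p_{\pi(j)}(\mathbf w)}\,dw_1\cdots dw_k$$ is equal to $$(-1)^{k-1}\Bigl(2-\frac{3}{2^k}\Bigr)+\sum_{j=2}^{k}(-1)^{k-j}\Bigl(2-\frac{1}{2^{k-j}}\Bigr)\zeta(j)$$ and to $$\sum_{j=1}^\infty\frac{2}{j^k(j+1)(j+2)}.$$
   Context: $\mathfrak S_k$ is the set of permutations of $\{1,\ldots,k\}$, and $\zeta(s)=\sum_{n\ge1}n^{-s}$ is the Riemann zeta function. Empty sums are $0$ and empty products are $1$. For $i\le k$, $p_i(\mathbf w)$ depends only on $w_1,\ldots,w_k$. *)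

theory Defs
  imports "HOL-Analysis.Analysis"
begin

text \<open>Indices start at 1; the value \<open>w 0\<close> is never used.\<close>

definition stick :: "(nat \<Rightarrow> real) \<Rightarrow> nat \<Rightarrow> real" where
  "stick w i = (\<Prod>j=1..<i. 1 - w j) * w i"

definition stick_perm :: "nat \<Rightarrow> (nat \<Rightarrow> nat) \<Rightarrow> (nat \<Rightarrow> real) \<Rightarrow> real" where
  "stick_perm k \<pi> w =
     stick w (\<pi> 1) * (\<Prod>i=2..k. stick w (\<pi> i) / (1 - (\<Sum>j=1..i-1. stick w (\<pi> j))))"

text \<open>Points of \<open>(0,1)\<^sup>k\<close> are functions on \<open>{1..k}\<close> (\<open>undefined\<close> elsewhere), and
  \<open>dw\<^sub>1 \<dots> dw\<^sub>k\<close> is the \<open>k\<close>-fold product of Lebesgue measure.\<close>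

abbreviation unit_cube :: "nat \<Rightarrow> (nat \<Rightarrow> real) set" where
  "unit_cube k \<equiv> (\<Pi>\<^sub>E i\<in>{1..k}. {0<..<1})"

abbreviation cube_measure :: "nat \<Rightarrow> (nat \<Rightarrow> real) measure" where
  "cube_measure k \<equiv> (\<Pi>\<^sub>M i\<in>{1..k}. lborel)"

text \<open>The Riemann zeta function on the half-line \<open>s > 1\<close>, where its series converges.\<close>

definition zeta :: "real \<Rightarrow> real" where
  "zeta s = (\<Sum>n. real (Suc n) powr (-s))"

end

theory Submission
  imports Defs "HOL-Combinatorics.Multiset_Permutations" "HOL-Real_Asymp.Real_Asymp"
begin

text \<open>
  For fixed \<open>w\<close> put \<open>x\<^sub>i = stick w i\<close> and \<open>r = (1 - w\<^sub>1) \<dots> (1 - w\<^sub>k)\<close>, so that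
  \<open>r + x\<^sub>1 + \<dots> + x\<^sub>k = 1\<close>. The sum over \<open>\<pi>\<close> of \<open>stick_perm k \<pi> w\<close> is the probability that,
  drawing without replacement with probabilities proportional to size, all of the pieces
  \<open>x\<^sub>1, \<dots>, x\<^sub>k\<close> come before the remainder \<open>r\<close>. Attach to every piece an independent exponential
  clock whose rate is its size; the first rings occur in the order of such a draw. Hence the sum is
  the probability that the clock of the remainder rings last:
  \<open>\<integral>\<^sub>0\<^sup>\<infinity> r exp (-r t) \<Prod>\<^sub>i (1 - exp (-x\<^sub>i t)) dt\<close>
  (lemmas \<open>sum_draw_weight_eq_clock_sum\<close> and \<open>clock_sum_eq_nn_integral\<close>).

  In this form the sticks can be integrated out one at a time, the last one first: each integration
  applies the operator \<open>(T g)(s) = \<integral>\<^sub>0\<^sup>1 (1 - exp (-s v)) g (s (1 - v)) dv\<close> (\<open>break_op\<close>). With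
  \<open>h s = s exp (-s)\<close> the quantity to be computed becomes \<open>\<integral>\<^sub>0\<^sup>\<infinity> (T\<^sup>k h)(t) / t dt\<close>
  (lemma \<open>nn_integral_sticks_eq_break_op\<close>).

  The adjoint of \<open>T\<close> has explicit eigenvectors among Laplace transforms. It maps \<open>t \<mapsto> exp (-q t)\<close>
  to \<open>s \<mapsto> \<integral>\<^sub>q\<^sup>\<infinity> exp (-x s) / (x (x + 1)) dx\<close>, and therefore a mixture of exponentials with density
  \<open>a\<close> to the one with density \<open>(\<integral>\<^sub>0\<^sup>x a) / (x (x + 1))\<close>. The densities
  \<open>a\<^sub>j x = x\<^bsup>j-1\<^esup> / (1 + x)\<^bsup>j+1\<^esup>\<close> with \<open>j \<ge> 1\<close> are eigenvectors with eigenvalue \<open>1 / j\<close>. The weight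
  \<open>1 / t\<close> is the mixture with density \<open>1\<close>; one application of the adjoint turns that density into
  \<open>1 / (x + 1) = \<Sum>\<^sub>j a\<^sub>j x\<close>, and the other \<open>k - 1\<close> applications contribute the factors
  \<open>1 / j\<^bsup>k-1\<^esup>\<close>. Since \<open>a\<^sub>j\<close> paired with \<open>h\<close> gives \<open>2 / (j (j + 1) (j + 2))\<close>, this is the series
  of the theorem (lemmas \<open>laplace_pairing_eigen_weight\<close>, \<open>laplace_pairing_one_break_op\<close> and
  \<open>laplace_pairing_one_funpow\<close>). All integrands are nonnegative, so every exchange of integrals is
  Tonelli's theorem, and integrability follows at the end from finiteness of the series.

  The zeta values enter through \<open>2 / ((j + 1) (j + 2)) = 2 / (j + 1) - 2 / (j + 2)\<close>: the series
  \<open>S\<^sub>k = \<Sum>\<^sub>j 1 / (j\<^sup>k (j + a))\<close> satisfies \<open>S\<^sub>k\<^sub>+\<^sub>1 = (zeta (k + 1) - S\<^sub>k) / a\<close> by partial fractions,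
  and \<open>S\<^sub>1\<close> telescopes for \<open>a = 1\<close> and \<open>a = 2\<close> (lemma \<open>sums_inverse_power_shift\<close>).
\<close>

section \<open>Integrals over open half-lines and intervals\<close>

lemma nn_integral_greaterThan_eq_atLeast:
  fixes f :: "real \<Rightarrow> ennreal"
  shows "(\<integral>\<^sup>+t. f t * indicator {a<..} t \<partial>lborel) = (\<integral>\<^sup>+t. f t * indicator {a..} t \<partial>lborel)"
  by (intro nn_integral_cong_AE eventually_mono[OF AE_lborel_singleton[of a]])
     (auto split: split_indicator)

lemma nn_integral_FTC_greaterThan:
  fixes f :: "real \<Rightarrow> real"
  assumes "f \<in> borel_measurable borel"
    and "\<And>x. a \<le> x \<Longrightarrow> DERIV F x :> f x"
    and "\<And>x. a \<le> x \<Longrightarrow> 0 \<le> f x"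
    and "(F \<longlongrightarrow> L) at_top"
  shows "(\<integral>\<^sup>+x. ennreal (f x) * indicator {a<..} x \<partial>lborel) = ennreal (L - F a)"
  unfolding nn_integral_greaterThan_eq_atLeast by (rule nn_integral_FTC_atLeast[OF assms])

lemma nn_integral_FTC_greaterThanLessThan:
  fixes f :: "real \<Rightarrow> real"
  assumes "f \<in> borel_measurable borel"
    and "\<And>x. a \<le> x \<Longrightarrow> DERIV F x :> f x"
    and "\<And>x. a \<le> x \<Longrightarrow> 0 \<le> f x"
    and "a \<le> b"
  shows "(\<integral>\<^sup>+x. ennreal (f x) * indicator {a<..<b} x \<partial>lborel) = ennreal (F b - F a)"
proof -
  have "(\<integral>\<^sup>+x. ennreal (f x) * indicator {a<..<b} x \<partial>lborel)
      = (\<integral>\<^sup>+x. ennreal (f x) * indicator {a..b} x \<partial>lborel)"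
    by (intro nn_integral_cong_AE
          eventually_mono[OF eventually_conj[OF AE_lborel_singleton[of a] AE_lborel_singleton[of b]]])
       (auto split: split_indicator)
  also have "\<dots> = ennreal (F b - F a)"
    using assms by (intro nn_integral_FTC_Icc) auto
  finally show ?thesis .
qed

section \<open>Size-biased draws and exponential clocks\<close>

text \<open>The probability of drawing the pieces in the order of the list, without replacement and
  proportionally to size, when \<open>c\<close> is the total size of what has not been drawn yet.\<close>
fun draw_weight :: "('a \<Rightarrow> real) \<Rightarrow> real \<Rightarrow> 'a list \<Rightarrow> real" where
  "draw_weight x c [] = 1"
| "draw_weight x c (a # l) = x a / c * draw_weight x (c - x a) l"

lemma draw_weight_eq_prod:
  "draw_weight x c l = (\<Prod>i<length l. x (l ! i) / (c - (\<Sum>j<i. x (l ! j))))"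
proof (induction l arbitrary: c)
  case (Cons a l)
  then show ?case
    by (simp add: prod.lessThan_Suc_shift sum.lessThan_Suc_shift diff_diff_eq
          del: prod.lessThan_Suc sum.lessThan_Suc)
qed simp

text \<open>The inclusion-exclusion form of the probability that a clock of rate \<open>r\<close> rings after all the
  clocks of rates \<open>x i\<close>, \<open>i \<in> S\<close>: the term \<open>r / (r + sum x T)\<close> is the probability that it rings
  before all those in \<open>T\<close>.\<close>
definition clock_sum :: "('a \<Rightarrow> real) \<Rightarrow> real \<Rightarrow> 'a set \<Rightarrow> real" where
  "clock_sum x r S = (\<Sum>T\<in>Pow S. (-1) ^ card T * (r / (r + sum x T)))"

lemma sum_Pow_sign_eq_0:
  assumes "finite S" "S \<noteq> {}"
  shows "(\<Sum>T\<in>Pow S. (-1) ^ card T :: real) = 0"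
proof -
  have "(\<Prod>i\<in>S. (-1) + 1 :: real) = (\<Sum>T\<in>Pow S. (\<Prod>i\<in>T. -1) * (\<Prod>i\<in>S - T. 1))"
    by (rule prod_add) fact
  then show ?thesis
    using assms by (simp add: power_0_left)
qed

text \<open>Conditioning on the clock that rings first. Algebraically, exchanging the two sums makes the
  set \<open>T\<close> contribute \<open>sum x S - sum x T = (r + sum x S) - (r + sum x T)\<close> times its term; the second
  part cancels the denominator and leaves an alternating sum over all subsets, which vanishes.\<close>
lemma clock_sum_step:
  fixes x :: "'a \<Rightarrow> real"
  assumes "finite S" "S \<noteq> {}" "r > 0" "\<And>i. i \<in> S \<Longrightarrow> x i \<ge> 0"
  shows "(\<Sum>i\<in>S. x i * clock_sum x r (S - {i})) = (r + sum x S) * clock_sum x r S"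
proof -
  let ?\<phi> = "\<lambda>T. (-1) ^ card T * (r / (r + sum x T))"
  have pos: "r + sum x T > 0" if "T \<subseteq> S" for T
    using that assms by (meson add_pos_nonneg subsetD sum_nonneg)
  have "(\<Sum>i\<in>S. x i * clock_sum x r (S - {i}))
      = (\<Sum>i\<in>S. \<Sum>T\<in>{T\<in>Pow S. i \<notin> T}. x i * ?\<phi> T)"
    unfolding clock_sum_def sum_distrib_left
    by (intro sum.cong refl) auto
  also have "\<dots> = (\<Sum>T\<in>Pow S. \<Sum>i\<in>{i\<in>S. i \<notin> T}. x i * ?\<phi> T)"
    using \<open>finite S\<close> by (intro sum.swap_restrict) auto
  also have "\<dots> = (\<Sum>T\<in>Pow S. (r + sum x S) * ?\<phi> T - r * (-1) ^ card T)"
  proof (intro sum.cong refl)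
    fix T assume T: "T \<in> Pow S"
    have "(\<Sum>i\<in>{i\<in>S. i \<notin> T}. x i) = sum x (S - T)"
      by (rule sum.cong) auto
    also have "\<dots> = sum x S - sum x T"
      using T \<open>finite S\<close> by (intro sum_diff) auto
    finally have "(\<Sum>i\<in>{i\<in>S. i \<notin> T}. x i * ?\<phi> T) = (sum x S - sum x T) * ?\<phi> T"
      by (simp only: sum_distrib_right [symmetric])
    also have "\<dots> = (r + sum x S) * ?\<phi> T - r * (-1) ^ card T"
      using pos[of T] T by (simp add: field_simps)
    finally show "(\<Sum>i\<in>{i\<in>S. i \<notin> T}. x i * ?\<phi> T) = (r + sum x S) * ?\<phi> T - r * (-1) ^ card T" .
  qed
  also have "\<dots> = (r + sum x S) * clock_sum x r S - r * (\<Sum>T\<in>Pow S. (-1) ^ card T)"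
    by (simp add: clock_sum_def sum_subtractf sum_distrib_left)
  finally show ?thesis
    using sum_Pow_sign_eq_0[OF assms(1,2)] by simp
qed

text \<open>Both sides satisfy the recursion obtained by splitting off the first piece drawn.\<close>
lemma sum_draw_weight_eq_clock_sum:
  fixes x :: "'a \<Rightarrow> real"
  assumes "finite S" "r > 0" "\<And>i. i \<in> S \<Longrightarrow> x i \<ge> 0"
  shows "(\<Sum>l\<in>permutations_of_set S. draw_weight x (r + sum x S) l) = clock_sum x r S"
  using assms
proof (induction S rule: finite_psubset_induct)
  case (psubset S)
  show ?case
  proof (cases "S = {}")
    case True
    then show ?thesis using psubset.prems by (simp add: clock_sum_def)
  next
    case False
    have pos: "r + sum x S > 0"
      using psubset.prems by (intro add_pos_nonneg sum_nonneg) auto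
    have "(\<Sum>l\<in>permutations_of_set S. draw_weight x (r + sum x S) l)
        = (\<Sum>i\<in>S. \<Sum>l\<in>(#) i ` permutations_of_set (S - {i}). draw_weight x (r + sum x S) l)"
      unfolding permutations_of_set_nonempty[OF False]
      using \<open>finite S\<close> by (subst sum.UNION_disjoint) auto
    also have "\<dots> = (\<Sum>i\<in>S. x i / (r + sum x S) * clock_sum x r (S - {i}))"
    proof (intro sum.cong refl)
      fix i assume i: "i \<in> S"
      have S: "r + sum x S - x i = r + sum x (S - {i})"
        using i \<open>finite S\<close> by (simp add: sum_diff1)
      have "(\<Sum>l\<in>(#) i ` permutations_of_set (S - {i}). draw_weight x (r + sum x S) l)
          = x i / (r + sum x S)
            * (\<Sum>l\<in>permutations_of_set (S - {i}). draw_weight x (r + sum x (S - {i})) l)"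
        by (subst sum.reindex) (auto simp: sum_distrib_left S)
      also have "(\<Sum>l\<in>permutations_of_set (S - {i}). draw_weight x (r + sum x (S - {i})) l)
          = clock_sum x r (S - {i})"
        using i psubset.prems by (intro psubset.IH) auto
      finally show "(\<Sum>l\<in>(#) i ` permutations_of_set (S - {i}). draw_weight x (r + sum x S) l)
          = x i / (r + sum x S) * clock_sum x r (S - {i})" .
    qed
    also have "\<dots> = (\<Sum>i\<in>S. x i * clock_sum x r (S - {i})) / (r + sum x S)"
      by (simp add: sum_divide_distrib)
    also have "\<dots> = clock_sum x r S"
      using clock_sum_step[OF \<open>finite S\<close> False, of r x] psubset.prems pos by simp
    finally show ?thesis .
  qed
qed

text \<open>Expanding the product turns the integrand into a signed sum of exponentials. Its obvious
  primitive tends to \<open>0\<close> at infinity and equals \<open>- clock_sum x r S\<close> at \<open>0\<close>. The fundamental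
  theorem applies to the whole sum, which is nonnegative although its terms are not.\<close>
lemma clock_sum_eq_nn_integral:
  fixes x :: "'a \<Rightarrow> real"
  assumes "finite S" "r > 0" "\<And>i. i \<in> S \<Longrightarrow> x i \<ge> 0"
  shows "(\<integral>\<^sup>+t. ennreal (r * exp (- r * t) * (\<Prod>i\<in>S. 1 - exp (- x i * t)))
            * indicator {0<..} t \<partial>lborel) = ennreal (clock_sum x r S)"
proof -
  define F where "F t = (\<Sum>T\<in>Pow S. - ((-1) ^ card T * (r / (r + sum x T))) * exp (- (r + sum x T) * t))" for t
  have pos: "r + sum x T > 0" if "T \<subseteq> S" for T
    using that assms by (meson add_pos_nonneg subsetD sum_nonneg)
  have expand: "r * exp (- r * t) * (\<Prod>i\<in>S. 1 - exp (- x i * t))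
      = (\<Sum>T\<in>Pow S. (-1) ^ card T * r * exp (- (r + sum x T) * t))" for t
  proof -
    have "(\<Prod>i\<in>S. 1 - exp (- x i * t)) = (\<Prod>i\<in>S. - exp (- x i * t) + 1)"
      by simp
    also have "\<dots> = (\<Sum>T\<in>Pow S. (\<Prod>i\<in>T. - exp (- x i * t)) * (\<Prod>i\<in>S - T. 1))"
      by (rule prod_add) fact
    also have "\<dots> = (\<Sum>T\<in>Pow S. (-1) ^ card T * exp (- sum x T * t))"
    proof (intro sum.cong refl)
      fix T assume "T \<in> Pow S"
      then have "finite T" using \<open>finite S\<close> by (auto intro: finite_subset)
      then show "(\<Prod>i\<in>T. - exp (- x i * t)) * (\<Prod>i\<in>S - T. 1) = (-1) ^ card T * exp (- sum x T * t)"
        by (simp add: prod_uminus exp_sum[symmetric] sum_negf sum_distrib_right)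
    qed
    finally show ?thesis
      by (simp add: sum_distrib_left mult_exp_exp algebra_simps)
  qed
  have "(\<integral>\<^sup>+t. ennreal (r * exp (- r * t) * (\<Prod>i\<in>S. 1 - exp (- x i * t)))
            * indicator {0<..} t \<partial>lborel) = ennreal (0 - F 0)"
  proof (rule nn_integral_FTC_greaterThan)
    show "DERIV F t :> r * exp (- r * t) * (\<Prod>i\<in>S. 1 - exp (- x i * t))" for t
      unfolding F_def expand
    proof (rule DERIV_sum)
      fix T assume "T \<in> Pow S"
      then have "r + sum x T \<noteq> 0"
        using pos[of T] by auto
      moreover have "((\<lambda>t. - ((-1) ^ card T * (r / c)) * exp (- c * t))
          has_field_derivative (-1) ^ card T * r * exp (- c * t)) (at t)" if "c \<noteq> 0" for c :: real
        using that by (auto intro!: derivative_eq_intros)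
      ultimately show "((\<lambda>t. - ((-1) ^ card T * (r / (r + sum x T))) * exp (- (r + sum x T) * t))
          has_field_derivative (-1) ^ card T * r * exp (- (r + sum x T) * t)) (at t)"
        by blast
    qed
    show "0 \<le> r * exp (- r * t) * (\<Prod>i\<in>S. 1 - exp (- x i * t))" if "0 \<le> t" for t
      using assms that by (intro mult_nonneg_nonneg prod_nonneg) auto
    have "((\<lambda>t. - ((-1) ^ card T * (r / (r + sum x T))) * exp (- (r + sum x T) * t)) \<longlongrightarrow> 0) at_top"
      if "T \<in> Pow S" for T
    proof -
      have "((\<lambda>t. exp (- c * t)) \<longlongrightarrow> 0) at_top" if "c > 0" for c :: real
        using that by real_asymp
      then have "((\<lambda>t. exp (- (r + sum x T) * t)) \<longlongrightarrow> 0) at_top"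
        using pos[of T] that by blast
      then show ?thesis
        by (rule tendsto_mult_right_zero)
    qed
    then show "(F \<longlongrightarrow> 0) at_top"
      unfolding F_def by (rule tendsto_null_sum)
  qed measurable
  also have "0 - F 0 = clock_sum x r S"
    by (simp add: F_def clock_sum_def sum_negf)
  finally show ?thesis .
qed

lemma sum_permutes_eq_sum_permutations_of_set:
  fixes f :: "nat list \<Rightarrow> real"
  shows "(\<Sum>\<pi> | \<pi> permutes {1..k}. f (map \<pi> [1..<Suc k])) = (\<Sum>l\<in>permutations_of_set {1..k}. f l)"
proof -
  have inj: "inj_on (\<lambda>\<pi>. map \<pi> [1..<Suc k]) {\<pi>. \<pi> permutes {1..k}}"
  proof (rule inj_onI, rule ext)
    fix \<pi> \<rho> :: "nat \<Rightarrow> nat" and i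
    assume "\<pi> \<in> {\<pi>. \<pi> permutes {1..k}}" "\<rho> \<in> {\<pi>. \<pi> permutes {1..k}}"
      and "map \<pi> [1..<Suc k] = map \<rho> [1..<Suc k]"
    then show "\<pi> i = \<rho> i"
      by (cases "i \<in> {1..k}") (auto simp: permutes_not_in map_eq_conv simp del: upt_Suc)
  qed
  have "(\<lambda>\<pi>. map \<pi> [1..<Suc k]) ` {\<pi>. \<pi> permutes {1..k}} = permutations_of_set {1..k}"
  proof (rule card_subset_eq)
    have set_upt: "set [1..<Suc k] = {1..k}" by auto
    show "(\<lambda>\<pi>. map \<pi> [1..<Suc k]) ` {\<pi>. \<pi> permutes {1..k}} \<subseteq> permutations_of_set {1..k}"
    proof (intro image_subsetI permutations_of_setI)
      fix \<pi> assume "\<pi> \<in> {\<pi>. \<pi> permutes {1..k}}"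
      then have \<pi>: "\<pi> permutes {1..k}" by simp
      show "set (map \<pi> [1..<Suc k]) = {1..k}"
        unfolding set_map set_upt by (rule permutes_image[OF \<pi>])
      show "distinct (map \<pi> [1..<Suc k])"
        unfolding distinct_map using permutes_inj_on[OF \<pi>] by (simp del: upt_Suc)
    qed
    show "card ((\<lambda>\<pi>. map \<pi> [1..<Suc k]) ` {\<pi>. \<pi> permutes {1..k}}) = card (permutations_of_set {1..k})"
      using card_image[OF inj] by (simp add: card_permutations del: upt_Suc)
  qed simp
  then show ?thesis
    using sum.reindex[OF inj, of f] by (simp del: upt_Suc)
qed

section \<open>Stick breaking\<close>

definition stick_rest :: "nat \<Rightarrow> (nat \<Rightarrow> real) \<Rightarrow> real" where
  "stick_rest k w = (\<Prod>j=1..k. 1 - w j)"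

lemma stick_rest_Suc: "stick_rest (Suc k) w = stick_rest k w * (1 - w (Suc k))"
  by (simp add: stick_rest_def)

lemma stick_eq_rest: "i \<ge> 1 \<Longrightarrow> stick w i = stick_rest (i - 1) w * w i"
  by (cases i) (simp_all add: stick_def stick_rest_def atLeastLessThanSuc_atLeastAtMost)

lemma stick_rest_add_sum: "stick_rest k w + (\<Sum>i=1..k. stick w i) = 1"
proof (induction k)
  case (Suc k)
  then show ?case by (simp add: stick_rest_Suc stick_eq_rest algebra_simps)
qed (simp add: stick_rest_def)

lemma stick_rest_pos: "w \<in> unit_cube k \<Longrightarrow> stick_rest k w > 0"
  unfolding stick_rest_def by (rule prod_pos) (auto simp: PiE_iff)

lemma stick_nonneg: "w \<in> unit_cube k \<Longrightarrow> i \<in> {1..k} \<Longrightarrow> stick w i \<ge> 0"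
  unfolding stick_def
  by (intro mult_nonneg_nonneg prod_nonneg) (auto simp: PiE_iff less_imp_le)

lemma measurable_stick [measurable]:
  "i \<in> {1..k} \<Longrightarrow> (\<lambda>w. stick w i) \<in> borel_measurable (cube_measure k)"
  unfolding stick_def by measurable

lemma measurable_stick_rest [measurable]:
  "j \<le> k \<Longrightarrow> stick_rest j \<in> borel_measurable (cube_measure k)"
  unfolding stick_rest_def by measurable

lemma sets_unit_cube [measurable]: "unit_cube k \<in> sets (cube_measure k)"
  by (rule sets_PiM_I_finite) auto

lemma stick_fun_upd: "i \<in> {1..k} \<Longrightarrow> stick (w(Suc k := v)) i = stick w i"
  unfolding stick_def by (auto intro!: prod.cong)

lemma stick_rest_fun_upd: "stick_rest k (w(Suc k := v)) = stick_rest k w"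
  unfolding stick_rest_def by (auto intro!: prod.cong)

lemma stick_perm_eq_draw_weight:
  assumes "k \<ge> 1"
  shows "stick_perm k \<pi> w = draw_weight (stick w) 1 (map \<pi> [1..<Suc k])"
proof -
  have "draw_weight (stick w) 1 (map \<pi> [1..<Suc k])
      = (\<Prod>i<k. stick w (\<pi> (Suc i)) / (1 - (\<Sum>j<i. stick w (\<pi> (Suc j)))))"
    by (auto simp: draw_weight_eq_prod nth_append simp del: upt_Suc intro!: prod.cong)
  also have "\<dots> = (\<Prod>i\<in>{1..k}. stick w (\<pi> i) / (1 - (\<Sum>j=1..i-1. stick w (\<pi> j))))"
  proof (rule prod.reindex_bij_witness[of _ "\<lambda>i. i - 1" Suc], goal_cases)
    case (5 i)
    have "(\<Sum>j<i. stick w (\<pi> (Suc j))) = (\<Sum>j=1..i. stick w (\<pi> j))"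
      by (rule sum.reindex_bij_witness[of _ "\<lambda>i. i - 1" Suc]) auto
    then show ?case by simp
  qed auto
  also have "\<dots> = stick_perm k \<pi> w"
    unfolding stick_perm_def using assms by (subst prod.atLeast_Suc_atMost) (auto simp: numeral_2_eq_2)
  finally show ?thesis ..
qed

text \<open>The denominators are nonnegative because the pieces and the remainder add up to \<open>1\<close>.\<close>
lemma stick_perm_nonneg:
  assumes w: "w \<in> unit_cube k" and \<pi>: "\<pi> permutes {1..k}" and "k \<ge> 1"
  shows "stick_perm k \<pi> w \<ge> 0"
proof -
  have nonneg: "stick w (\<pi> i) \<ge> 0" if "i \<in> {1..k}" for i
    using stick_nonneg[OF w] permutes_in_image[OF \<pi>] that by blast
  have "(\<Sum>j=1..i-1. stick w (\<pi> j)) \<le> 1" if "i \<in> {2..k}" for i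
  proof -
    have "(\<Sum>j=1..i-1. stick w (\<pi> j)) \<le> (\<Sum>j=1..k. stick w (\<pi> j))"
      using that nonneg by (intro sum_mono2) auto
    also have "\<dots> = (\<Sum>j=1..k. stick w j)"
      using sum.permute[OF \<pi>, of "stick w"] by (simp add: comp_def)
    also have "\<dots> \<le> 1"
      using stick_rest_add_sum[of k w] stick_rest_pos[OF w] by linarith
    finally show ?thesis .
  qed
  then show ?thesis
    unfolding stick_perm_def using \<open>k \<ge> 1\<close>
    by (intro mult_nonneg_nonneg prod_nonneg ballI divide_nonneg_nonneg nonneg) auto
qed

lemma measurable_stick_perm:
  assumes \<pi>: "\<pi> permutes {1..k}" and "k \<ge> 1"
  shows "stick_perm k \<pi> \<in> borel_measurable (cube_measure k)"
proof -
  have stick: "(\<lambda>w. stick w (\<pi> i)) \<in> borel_measurable (cube_measure k)" if "1 \<le> i" "i \<le> k" for i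
    using permutes_in_image[OF \<pi>, of i] that by (intro measurable_stick) auto
  show ?thesis
    unfolding stick_perm_def[abs_def] using \<open>k \<ge> 1\<close>
    by (intro borel_measurable_times borel_measurable_prod borel_measurable_divide
          borel_measurable_diff borel_measurable_sum borel_measurable_const stick) auto
qed

lemma sum_stick_perm_eq_nn_integral:
  assumes w: "w \<in> unit_cube k" and "k \<ge> 1"
  shows "(\<Sum>\<pi> | \<pi> permutes {1..k}. ennreal (stick_perm k \<pi> w))
    = (\<integral>\<^sup>+t. ennreal (stick_rest k w * exp (- stick_rest k w * t) * (\<Prod>i=1..k. 1 - exp (- stick w i * t)))
         * indicator {0<..} t \<partial>lborel)"
proof -
  have "(\<Sum>\<pi> | \<pi> permutes {1..k}. stick_perm k \<pi> w)
      = (\<Sum>l\<in>permutations_of_set {1..k}. draw_weight (stick w) 1 l)"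
    using \<open>k \<ge> 1\<close>
    by (simp only: stick_perm_eq_draw_weight sum_permutes_eq_sum_permutations_of_set)
  also have "\<dots> = clock_sum (stick w) (stick_rest k w) {1..k}"
    using sum_draw_weight_eq_clock_sum[of "{1..k}" "stick_rest k w" "stick w"]
      stick_rest_pos[OF w] stick_nonneg[OF w] by (simp only: stick_rest_add_sum finite_atLeastAtMost)
  finally have "(\<Sum>\<pi> | \<pi> permutes {1..k}. ennreal (stick_perm k \<pi> w))
      = ennreal (clock_sum (stick w) (stick_rest k w) {1..k})"
    by (subst sum_ennreal) (simp_all only: mem_Collect_eq stick_perm_nonneg[OF w _ \<open>k \<ge> 1\<close>])
  then show ?thesis
    using clock_sum_eq_nn_integral[of "{1..k}" "stick_rest k w" "stick w"]
      stick_rest_pos[OF w] stick_nonneg[OF w] by simp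
qed

section \<open>Integrating out the sticks\<close>

text \<open>One stick integrated out. If \<open>s = t r\<close> is the length \<open>r\<close> still available, in units of \<open>1 / t\<close>,
  then breaking off the fraction \<open>v\<close> creates a piece whose clock rings before time \<open>t\<close> with
  probability \<open>1 - exp (- s v)\<close> and leaves the length \<open>s (1 - v)\<close>.\<close>
definition break_op :: "(real \<Rightarrow> ennreal) \<Rightarrow> real \<Rightarrow> ennreal" where
  "break_op g s = (\<integral>\<^sup>+v. ennreal (1 - exp (- s * v)) * g (s * (1 - v)) * indicator {0<..<1} v \<partial>lborel)"

lemma measurable_break_op [measurable]:
  assumes [measurable]: "g \<in> borel_measurable borel"
  shows "break_op g \<in> borel_measurable borel"
  unfolding break_op_def by measurable

lemma measurable_break_op_funpow [measurable]:
  "g \<in> borel_measurable borel \<Longrightarrow> (break_op ^^ k) g \<in> borel_measurable borel"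
  by (induction k) auto

text \<open>The sticks \<open>1, \<dots>, k\<close> do not depend on the last variable \<open>w\<^sub>k\<^sub>+\<^sub>1\<close>, so integrating over
  it first only replaces \<open>g\<close> by \<open>break_op g\<close>. This is why the induction is over all \<open>g\<close>.\<close>
lemma nn_integral_sticks_eq_break_op:
  assumes "g \<in> borel_measurable borel" "t > 0"
  shows "(\<integral>\<^sup>+w. ennreal (\<Prod>i=1..k. 1 - exp (- stick w i * t)) * g (t * stick_rest k w)
            * indicator (unit_cube k) w \<partial>cube_measure k) = (break_op ^^ k) g t"
  using assms(1)
proof (induction k arbitrary: g)
  case 0
  then show ?case
    by (simp add: PiM_empty stick_rest_def nn_integral_count_space_finite)
next
  case (Suc k)
  note [measurable] = Suc.prems
  interpret product_sigma_finite "\<lambda>_::nat. lborel :: real measure" ..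
  let ?f = "\<lambda>k g w. ennreal (\<Prod>i=1..k. 1 - exp (- stick w i * t)) * g (t * stick_rest k w)
              * indicator (unit_cube k) w"
  have ins: "{1..Suc k} = insert (Suc k) {1..k}" by auto
  have meas: "?f (Suc k) g \<in> borel_measurable (cube_measure (Suc k))"
    by measurable
  have inner: "(\<integral>\<^sup>+v. ?f (Suc k) g (w(Suc k := v)) \<partial>lborel) = ?f k (break_op g) w"
    if w: "w \<in> space (cube_measure k)" for w
  proof -
    have ext: "w \<in> extensional {1..k}"
      using w by (simp add: space_PiM PiE_def)
    have "?f (Suc k) g (w(Suc k := v))
        = (ennreal (\<Prod>i=1..k. 1 - exp (- stick w i * t)) * indicator (unit_cube k) w) *
          (ennreal (1 - exp (- (t * stick_rest k w) * v)) * g (t * stick_rest k w * (1 - v))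
            * indicator {0<..<1} v)" for v
    proof (cases "w \<in> unit_cube k \<and> v \<in> {0<..<1}")
      case True
      have "w(Suc k := v) \<in> unit_cube (Suc k)"
        using True ext by (auto simp: PiE_iff extensional_def)
      moreover have "(\<Prod>i=1..k. 1 - exp (- stick (w(Suc k := v)) i * t))
          = (\<Prod>i=1..k. 1 - exp (- stick w i * t))"
        by (intro prod.cong) (auto simp: stick_fun_upd)
      moreover have "0 \<le> (\<Prod>i=1..k. 1 - exp (- stick w i * t))"
        using True stick_nonneg[of w k] \<open>t > 0\<close> by (intro prod_nonneg) auto
      moreover have "0 \<le> 1 - exp (- (t * stick_rest k w) * v)"
        using True stick_rest_pos[of w k] \<open>t > 0\<close> by auto
      ultimately show ?thesis
        using True
        by (simp add: stick_eq_rest stick_rest_Suc stick_rest_fun_upd ennreal_mult mult_ac)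
    next
      case False
      have "w(Suc k := v) \<notin> unit_cube (Suc k)"
      proof
        assume *: "w(Suc k := v) \<in> unit_cube (Suc k)"
        have "w i \<in> {0<..<1}" if "i \<in> {1..k}" for i
          using PiE_mem[OF *, of i] that by auto
        moreover have "v \<in> {0<..<1}"
          using PiE_mem[OF *, of "Suc k"] by auto
        ultimately show False
          using False ext by (auto simp: PiE_iff)
      qed
      then show ?thesis
        using False by (auto simp: indicator_def)
    qed
    then have "(\<integral>\<^sup>+v. ?f (Suc k) g (w(Suc k := v)) \<partial>lborel)
        = ennreal (\<Prod>i=1..k. 1 - exp (- stick w i * t)) * indicator (unit_cube k) w *
          break_op g (t * stick_rest k w)"
      unfolding break_op_def by (subst nn_integral_cmult [symmetric]) simp_all
    then show ?thesis
      by (simp only: mult_ac)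
  qed
  have "(\<integral>\<^sup>+w. ?f (Suc k) g w \<partial>cube_measure (Suc k))
      = (\<integral>\<^sup>+w. (\<integral>\<^sup>+v. ?f (Suc k) g (w(Suc k := v)) \<partial>lborel) \<partial>cube_measure k)"
    using product_nn_integral_insert[OF _ _ meas[unfolded ins], folded ins] by simp
  also have "\<dots> = (\<integral>\<^sup>+w. ?f k (break_op g) w \<partial>cube_measure k)"
    by (intro nn_integral_cong inner)
  also have "\<dots> = (break_op ^^ k) (break_op g) t"
    by (rule Suc.IH) measurable
  finally show ?case
    by (simp add: funpow_swap1)
qed

section \<open>The adjoint of the breaking operator on Laplace transforms\<close>

lemma nn_integral_exp_greaterThan:
  assumes "t > 0"
  shows "(\<integral>\<^sup>+x. ennreal (exp (- x * t)) * indicator {q<..} x \<partial>lborel) = ennreal (exp (- q * t) / t)"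
proof -
  have "(\<integral>\<^sup>+x. ennreal (exp (- x * t)) * indicator {q<..} x \<partial>lborel)
      = ennreal (0 - (- exp (- q * t) / t))"
  proof (rule nn_integral_FTC_greaterThan)
    show "((\<lambda>x. - exp (- x * t) / t) \<longlongrightarrow> 0) at_top"
      using assms by real_asymp
  qed (use assms in \<open>auto intro!: derivative_eq_intros\<close>)
  then show ?thesis by simp
qed

text \<open>The value is \<open>exp (- x s) (1 / x - 1 / (x + 1))\<close>, the two terms coming from \<open>exp (- x t)\<close> and
  \<open>exp (s - (x + 1) t)\<close>.\<close>
lemma nn_integral_gap_weight:
  assumes "x > 0"
  shows "(\<integral>\<^sup>+t. ennreal (exp (- x * t) * (1 - exp (s - t))) * indicator {s<..} t \<partial>lborel)
    = ennreal (exp (- x * s) / (x * (x + 1)))"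
proof -
  let ?F = "\<lambda>t. exp (s - (x + 1) * t) / (x + 1) - exp (- x * t) / x"
  have "(\<integral>\<^sup>+t. ennreal (exp (- x * t) * (1 - exp (s - t))) * indicator {s<..} t \<partial>lborel)
      = ennreal (0 - ?F s)"
  proof (rule nn_integral_FTC_greaterThan[where F = ?F])
    have "x + 1 > 0" using assms by simp
    then show "(?F \<longlongrightarrow> 0) at_top"
      using assms by real_asymp
    show "(?F has_field_derivative exp (- x * t) * (1 - exp (s - t))) (at t)" for t
    proof -
      have "exp (- x * t) * (1 - exp (s - t)) = exp (- x * t) - exp (s - (x + 1) * t)"
        by (simp add: right_diff_distrib mult_exp_exp algebra_simps)
      moreover have "((\<lambda>t. exp (s - c * t) / c - exp (- x * t) / x)
          has_field_derivative exp (- x * t) - exp (s - c * t)) (at t)" if "c > 0" for c :: real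
        using assms that by (auto intro!: derivative_eq_intros)
      ultimately show ?thesis
        using assms by simp
    qed
  qed auto
  also have "0 - ?F s = exp (- x * s) / (x * (x + 1))"
  proof -
    have "s - (x + 1) * s = - x * s" by (simp add: algebra_simps)
    then show ?thesis using assms by (simp add: divide_simps) (simp add: algebra_simps)
  qed
  finally show ?thesis .
qed

definition laplace :: "(real \<Rightarrow> ennreal) \<Rightarrow> real \<Rightarrow> ennreal" where
  "laplace g q = (\<integral>\<^sup>+t. ennreal (exp (- q * t)) * g t * indicator {0<..} t \<partial>lborel)"

lemma measurable_laplace [measurable]:
  assumes [measurable]: "g \<in> borel_measurable borel"
  shows "laplace g \<in> borel_measurable borel"
  unfolding laplace_def by measurable

text \<open>The substitution \<open>s = t (1 - v)\<close>; in this form the kernel depends only on \<open>t - s\<close>, apart from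
  the factor \<open>1 / t\<close>.\<close>
lemma break_op_eq:
  assumes [measurable]: "g \<in> borel_measurable borel" and "t > 0"
  shows "break_op g t = ennreal (1 / t) *
    (\<integral>\<^sup>+s. ennreal (1 - exp (s - t)) * g s * indicator {0<..<t} s \<partial>lborel)"
proof -
  have "(\<integral>\<^sup>+s. ennreal (1 - exp (s - t)) * g s * indicator {0<..<t} s \<partial>lborel)
      = ennreal \<bar>- t\<bar> * (\<integral>\<^sup>+v. ennreal (1 - exp ((t + - t * v) - t)) * g (t + - t * v)
          * indicator {0<..<t} (t + - t * v) \<partial>lborel)"
    using \<open>t > 0\<close> by (intro nn_integral_real_affine) auto
  also have "(\<integral>\<^sup>+v. ennreal (1 - exp ((t + - t * v) - t)) * g (t + - t * v)
          * indicator {0<..<t} (t + - t * v) \<partial>lborel) = break_op g t"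
    unfolding break_op_def
  proof (intro nn_integral_cong arg_cong2[where f = "(*)"])
    fix v :: real
    have "0 < t + - t * v \<longleftrightarrow> v < 1"
      using \<open>t > 0\<close> by simp
    then show "(indicator {0<..<t} (t + - t * v) :: ennreal) = indicator {0<..<1} v"
      using \<open>t > 0\<close> by (auto simp: indicator_def zero_less_mult_iff)
  qed (simp_all add: algebra_simps)
  finally show ?thesis
    using \<open>t > 0\<close> by (simp add: mult.assoc[symmetric] ennreal_mult[symmetric])
qed

text \<open>The factor \<open>1 / t\<close> in \<open>break_op\<close> is absorbed by
  \<open>exp (- q t) / t = \<integral>\<^sub>q\<^sup>\<infinity> exp (- x t) dx\<close>. What is left inside is a convolution with
  \<open>1 - exp (- u)\<close>, whose Laplace transform at \<open>x\<close> is \<open>1 / (x (x + 1))\<close>.\<close>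
lemma laplace_break_op:
  assumes [measurable]: "g \<in> borel_measurable borel" and "q \<ge> 0"
  shows "laplace (break_op g) q
    = (\<integral>\<^sup>+x. ennreal (1 / (x * (x + 1))) * laplace g x * indicator {q<..} x \<partial>lborel)"
proof -
  \<comment> \<open>The integrand after \<open>exp (- q t) / t\<close> has been written as an integral over \<open>x\<close>.\<close>
  define K :: "real \<Rightarrow> real \<Rightarrow> real \<Rightarrow> ennreal" where
    "K x s t = (if q < x \<and> 0 < s \<and> s < t
                then ennreal (exp (- x * t)) * (ennreal (1 - exp (s - t)) * g s) else 0)" for x s t
  have "laplace (break_op g) q = (\<integral>\<^sup>+t. (\<integral>\<^sup>+s. (\<integral>\<^sup>+x. K x s t \<partial>lborel) \<partial>lborel) \<partial>lborel)"
    unfolding laplace_def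
  proof (intro nn_integral_cong)
    fix t :: real
    show "ennreal (exp (- q * t)) * break_op g t * indicator {0<..} t
        = (\<integral>\<^sup>+s. (\<integral>\<^sup>+x. K x s t \<partial>lborel) \<partial>lborel)"
    proof (cases "t > 0")
      case True
      have K: "(\<integral>\<^sup>+x. K x s t \<partial>lborel) = ennreal (exp (- q * t) / t) *
          (ennreal (1 - exp (s - t)) * g s * indicator {0<..<t} s)" for s
      proof -
        have "(\<integral>\<^sup>+x. K x s t \<partial>lborel) = (\<integral>\<^sup>+x. (ennreal (exp (- x * t)) * indicator {q<..} x)
            * (ennreal (1 - exp (s - t)) * g s * indicator {0<..<t} s) \<partial>lborel)"
          by (intro nn_integral_cong) (auto simp: K_def indicator_def)
        also have "\<dots> = (\<integral>\<^sup>+x. ennreal (exp (- x * t)) * indicator {q<..} x \<partial>lborel)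
            * (ennreal (1 - exp (s - t)) * g s * indicator {0<..<t} s)"
          by (rule nn_integral_multc) measurable
        finally show ?thesis
          by (simp only: nn_integral_exp_greaterThan[OF True])
      qed
      show ?thesis
        unfolding K using True
        by (subst nn_integral_cmult)
           (simp_all add: break_op_eq mult.assoc[symmetric] ennreal_mult[symmetric])
    next
      case False
      then have "K x s t = 0" for x s
        by (auto simp: K_def)
      then show ?thesis
        using False by simp
    qed
  qed
  also have "\<dots> = (\<integral>\<^sup>+t. (\<integral>\<^sup>+x. (\<integral>\<^sup>+s. K x s t \<partial>lborel) \<partial>lborel) \<partial>lborel)"
    by (intro nn_integral_cong lborel_pair.Fubini') (simp add: K_def)
  also have "\<dots> = (\<integral>\<^sup>+x. (\<integral>\<^sup>+t. (\<integral>\<^sup>+s. K x s t \<partial>lborel) \<partial>lborel) \<partial>lborel)"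
    by (rule lborel_pair.Fubini') (simp add: K_def)
  also have "\<dots> = (\<integral>\<^sup>+x. (\<integral>\<^sup>+s. (\<integral>\<^sup>+t. K x s t \<partial>lborel) \<partial>lborel) \<partial>lborel)"
    by (intro nn_integral_cong lborel_pair.Fubini') (simp add: K_def)
  also have "\<dots> = (\<integral>\<^sup>+x. ennreal (1 / (x * (x + 1))) * laplace g x * indicator {q<..} x \<partial>lborel)"
  proof (intro nn_integral_cong)
    fix x :: real
    show "(\<integral>\<^sup>+s. (\<integral>\<^sup>+t. K x s t \<partial>lborel) \<partial>lborel)
        = ennreal (1 / (x * (x + 1))) * laplace g x * indicator {q<..} x"
    proof (cases "q < x")
      case True
      then have "x > 0" using \<open>q \<ge> 0\<close> by simp
      have K: "(\<integral>\<^sup>+t. K x s t \<partial>lborel)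
          = ennreal (1 / (x * (x + 1))) * (ennreal (exp (- x * s)) * g s * indicator {0<..} s)" for s
      proof -
        have "(\<integral>\<^sup>+t. K x s t \<partial>lborel)
            = (\<integral>\<^sup>+t. (ennreal (exp (- x * t) * (1 - exp (s - t))) * indicator {s<..} t)
                * (g s * indicator {0<..} s) \<partial>lborel)"
          using True by (intro nn_integral_cong) (auto simp: K_def indicator_def ennreal_mult mult_ac)
        also have "\<dots> = (\<integral>\<^sup>+t. ennreal (exp (- x * t) * (1 - exp (s - t))) * indicator {s<..} t \<partial>lborel)
            * (g s * indicator {0<..} s)"
          by (rule nn_integral_multc) measurable
        finally show ?thesis
          unfolding nn_integral_gap_weight[OF \<open>x > 0\<close>]
          using \<open>x > 0\<close> by (simp add: mult.assoc[symmetric] ennreal_mult[symmetric])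
      qed
      show ?thesis
        unfolding K laplace_def using True by (subst nn_integral_cmult) auto
    qed (auto simp: K_def)
  qed
  finally show ?thesis .
qed

text \<open>By Tonelli this is the integral of \<open>g\<close> over \<open>(0, \<infinity>)\<close> against the mixture
  \<open>t \<mapsto> \<integral>\<^sub>0\<^sup>\<infinity> a q exp (- q t) dq\<close> of exponentials, so operators acting on \<open>g\<close> have adjoints acting on
  the density \<open>a\<close>.\<close>
definition laplace_pairing :: "(real \<Rightarrow> real) \<Rightarrow> (real \<Rightarrow> ennreal) \<Rightarrow> ennreal" where
  "laplace_pairing a g = (\<integral>\<^sup>+q. ennreal (a q) * laplace g q * indicator {0<..} q \<partial>lborel)"

lemma laplace_pairing_cong:
  "(\<And>q. q > 0 \<Longrightarrow> a q = b q) \<Longrightarrow> laplace_pairing a g = laplace_pairing b g"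
  unfolding laplace_pairing_def by (intro nn_integral_cong) (auto simp: indicator_def)

text \<open>The adjoint of \<open>break_op\<close> acts on densities by \<open>a \<mapsto> A / (x (x + 1))\<close> with \<open>A\<close> the
  primitive of \<open>a\<close> vanishing at \<open>0\<close>: exchange the integrals over \<open>0 < q < x\<close> in
  \<open>laplace_break_op\<close>.\<close>
lemma laplace_pairing_break_op:
  assumes [measurable]: "g \<in> borel_measurable borel" "a \<in> borel_measurable borel"
    and deriv: "\<And>x. x \<ge> 0 \<Longrightarrow> DERIV A x :> a x" and nonneg: "\<And>x. x \<ge> 0 \<Longrightarrow> a x \<ge> 0"
    and "A 0 = 0"
  shows "laplace_pairing a (break_op g) = laplace_pairing (\<lambda>x. A x / (x * (x + 1))) g"
proof -
  define K :: "real \<Rightarrow> real \<Rightarrow> ennreal" where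
    "K x q = (if 0 < q \<and> q < x then ennreal (a q) * (ennreal (1 / (x * (x + 1))) * laplace g x) else 0)"
    for x q
  have "laplace_pairing a (break_op g) = (\<integral>\<^sup>+q. (\<integral>\<^sup>+x. K x q \<partial>lborel) \<partial>lborel)"
    unfolding laplace_pairing_def
  proof (intro nn_integral_cong)
    fix q :: real
    show "ennreal (a q) * laplace (break_op g) q * indicator {0<..} q = (\<integral>\<^sup>+x. K x q \<partial>lborel)"
    proof (cases "q > 0")
      case True
      have "(\<integral>\<^sup>+x. K x q \<partial>lborel)
          = (\<integral>\<^sup>+x. ennreal (a q) * (ennreal (1 / (x * (x + 1))) * laplace g x * indicator {q<..} x) \<partial>lborel)"
        using True by (intro nn_integral_cong) (auto simp: K_def indicator_def)
      also have "\<dots> = ennreal (a q) *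
          (\<integral>\<^sup>+x. ennreal (1 / (x * (x + 1))) * laplace g x * indicator {q<..} x \<partial>lborel)"
        by (rule nn_integral_cmult) measurable
      finally show ?thesis
        using True by (simp add: laplace_break_op)
    qed (simp add: K_def)
  qed
  also have "\<dots> = (\<integral>\<^sup>+x. (\<integral>\<^sup>+q. K x q \<partial>lborel) \<partial>lborel)"
    by (rule lborel_pair.Fubini') (simp add: K_def)
  also have "\<dots> = laplace_pairing (\<lambda>x. A x / (x * (x + 1))) g"
    unfolding laplace_pairing_def
  proof (intro nn_integral_cong)
    fix x :: real
    show "(\<integral>\<^sup>+q. K x q \<partial>lborel)
        = ennreal (A x / (x * (x + 1))) * laplace g x * indicator {0<..} x"
    proof (cases "x > 0")
      case True
      have "(\<integral>\<^sup>+q. K x q \<partial>lborel) = (\<integral>\<^sup>+q. (ennreal (a q) * indicator {0<..<x} q)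
          * (ennreal (1 / (x * (x + 1))) * laplace g x) \<partial>lborel)"
        by (intro nn_integral_cong) (auto simp: K_def indicator_def)
      also have "\<dots> = (\<integral>\<^sup>+q. ennreal (a q) * indicator {0<..<x} q \<partial>lborel)
          * (ennreal (1 / (x * (x + 1))) * laplace g x)"
        by (rule nn_integral_multc) measurable
      also have "(\<integral>\<^sup>+q. ennreal (a q) * indicator {0<..<x} q \<partial>lborel) = ennreal (A x - A 0)"
        using True deriv nonneg by (intro nn_integral_FTC_greaterThanLessThan) auto
      finally show ?thesis
        using True \<open>A 0 = 0\<close>
        by (simp add: mult.assoc[symmetric] ennreal_mult''[symmetric])
    next
      case False
      then have "K x q = 0" for q
        by (auto simp: K_def)
      then show ?thesis
        using False by simp
    qed
  qed
  finally show ?thesis .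
qed

text \<open>With \<open>z = q / (1 + q)\<close> this is \<open>z\<^sup>n dz/dq\<close>. Since \<open>dx / (x (x + 1)) = dz / z\<close>, the adjoint
  becomes \<open>f \<mapsto> (\<integral>\<^sub>0\<^sup>z f) / z\<close> on densities in the variable \<open>z\<close>, which has the monomials as
  eigenvectors. The index is shifted: \<open>eigen_weight n\<close> has eigenvalue \<open>1 / (n + 1)\<close>.\<close>
definition eigen_weight :: "nat \<Rightarrow> real \<Rightarrow> real" where
  "eigen_weight n q = q ^ n / (1 + q) ^ (n + 2)"

lemma measurable_eigen_weight [measurable]: "eigen_weight n \<in> borel_measurable borel"
  unfolding eigen_weight_def by measurable

lemma eigen_weight_nonneg: "q \<ge> 0 \<Longrightarrow> eigen_weight n q \<ge> 0"
  by (simp add: eigen_weight_def)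

lemma has_deriv_ratio_power:
  assumes "(q::real) \<ge> 0"
  shows "((\<lambda>q. (q / (1 + q)) ^ Suc n / real (Suc n)) has_field_derivative eigen_weight n q) (at q)"
proof -
  have q: "1 + q \<noteq> 0" using assms by simp
  have "((\<lambda>q. q / (1 + q)) has_field_derivative 1 / (1 + q) ^ 2) (at q)"
    using q by (auto intro!: derivative_eq_intros simp: power2_eq_square)
  from DERIV_cdivide[OF DERIV_power[OF this, of "Suc n"], of "real (Suc n)"]
  show ?thesis
    by (simp add: eigen_weight_def power_divide power_add power2_eq_square mult_ac del: of_nat_Suc)
qed

lemma laplace_pairing_eigen_weight:
  assumes "g \<in> borel_measurable borel"
  shows "laplace_pairing (eigen_weight n) (break_op g)
    = ennreal (1 / real (Suc n)) * laplace_pairing (eigen_weight n) g"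
proof -
  have "laplace_pairing (eigen_weight n) (break_op g)
      = laplace_pairing (\<lambda>x. (x / (1 + x)) ^ Suc n / real (Suc n) / (x * (x + 1))) g"
    by (rule laplace_pairing_break_op)
       (auto simp: assms has_deriv_ratio_power eigen_weight_nonneg simp del: of_nat_Suc power_Suc)
  also have "\<dots> = laplace_pairing (\<lambda>x. 1 / real (Suc n) * eigen_weight n x) g"
    by (rule laplace_pairing_cong)
       (simp add: eigen_weight_def power_divide mult_ac add.commute del: of_nat_Suc)
  also have "\<dots> = ennreal (1 / real (Suc n)) * laplace_pairing (eigen_weight n) g"
    unfolding laplace_pairing_def using assms
    by (subst nn_integral_cmult[symmetric]) (auto simp: ennreal_mult'[symmetric] mult.assoc[symmetric])
  finally show ?thesis .
qed

lemma laplace_pairing_eigen_weight_funpow: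
  assumes "g \<in> borel_measurable borel"
  shows "laplace_pairing (eigen_weight n) ((break_op ^^ k) g)
    = ennreal (1 / real (Suc n) ^ k) * laplace_pairing (eigen_weight n) g"
proof (induction k)
  case (Suc k)
  then show ?case
    using assms
    by (simp add: laplace_pairing_eigen_weight mult.assoc[symmetric] ennreal_mult[symmetric] del: of_nat_Suc)
qed simp

text \<open>The geometric series in \<open>z = x / (1 + x)\<close>.\<close>
lemma eigen_weight_sums:
  assumes "x > 0"
  shows "(\<lambda>n. eigen_weight n x) sums (1 / (x + 1))"
proof -
  have "(\<lambda>n. 1 / (1 + x) ^ 2 * (x / (1 + x)) ^ n) sums (1 / (1 + x) ^ 2 * (1 / (1 - x / (1 + x))))"
    using assms by (intro sums_mult geometric_sums) auto
  moreover have "1 / (1 + x) ^ 2 * (1 / (1 - x / (1 + x))) = 1 / (x + 1)"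
  proof -
    have "1 - x / (1 + x) = 1 / (1 + x)"
      using assms by (simp add: field_simps)
    then show ?thesis
      by (simp add: power2_eq_square add.commute)
  qed
  ultimately show ?thesis
    by (simp add: eigen_weight_def power_divide power2_eq_square mult_ac)
qed

text \<open>The constant density \<open>1\<close> has primitive \<open>x\<close>, so the adjoint sends it to \<open>1 / (x + 1)\<close>, which
  is the sum of all the eigenvectors.\<close>
lemma laplace_pairing_one_break_op:
  assumes [measurable]: "g \<in> borel_measurable borel"
  shows "laplace_pairing (\<lambda>_. 1) (break_op g) = (\<Sum>n. laplace_pairing (eigen_weight n) g)"
proof -
  have "laplace_pairing (\<lambda>_. 1) (break_op g) = laplace_pairing (\<lambda>x. x / (x * (x + 1))) g"
    by (rule laplace_pairing_break_op) auto
  also have "\<dots> = (\<integral>\<^sup>+q. (\<Sum>n. ennreal (eigen_weight n q) * laplace g q * indicator {0<..} q) \<partial>lborel)"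
    unfolding laplace_pairing_def
  proof (intro nn_integral_cong)
    fix q :: real
    have "(\<Sum>n. ennreal (eigen_weight n q)) = ennreal (q / (q * (q + 1)))" if "q > 0"
    proof -
      have "(\<Sum>n. ennreal (eigen_weight n q)) = ennreal (1 / (q + 1))"
        using that eigen_weight_sums[OF that]
        by (intro sums_unique[symmetric] sums_ennreal[THEN iffD2]) (auto simp: eigen_weight_def)
      then show ?thesis using that by simp
    qed
    then show "ennreal (q / (q * (q + 1))) * laplace g q * indicator {0<..} q
        = (\<Sum>n. ennreal (eigen_weight n q) * laplace g q * indicator {0<..} q)"
      by (cases "q > 0") (simp_all add: ennreal_suminf_multc)
  qed
  also have "\<dots> = (\<Sum>n. laplace_pairing (eigen_weight n) g)"
    unfolding laplace_pairing_def by (rule nn_integral_suminf) measurable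
  finally show ?thesis .
qed

text \<open>The constant density represents the weight \<open>1 / t = \<integral>\<^sub>0\<^sup>\<infinity> exp (- q t) dq\<close>.\<close>
lemma laplace_pairing_one:
  assumes [measurable]: "g \<in> borel_measurable borel"
  shows "laplace_pairing (\<lambda>_. 1) g = (\<integral>\<^sup>+t. ennreal (1 / t) * g t * indicator {0<..} t \<partial>lborel)"
proof -
  define K :: "real \<Rightarrow> real \<Rightarrow> ennreal" where
    "K t q = ennreal (exp (- q * t)) * indicator {0<..} q * (g t * indicator {0<..} t)" for t q
  have "laplace_pairing (\<lambda>_. 1) g = (\<integral>\<^sup>+q. (\<integral>\<^sup>+t. K t q \<partial>lborel) \<partial>lborel)"
    unfolding laplace_pairing_def laplace_def K_def
    by (intro nn_integral_cong) (auto simp: indicator_def mult_ac intro!: nn_integral_cong)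
  also have "\<dots> = (\<integral>\<^sup>+t. (\<integral>\<^sup>+q. K t q \<partial>lborel) \<partial>lborel)"
    by (rule lborel_pair.Fubini') (simp add: K_def)
  also have "\<dots> = (\<integral>\<^sup>+t. ennreal (1 / t) * g t * indicator {0<..} t \<partial>lborel)"
  proof (intro nn_integral_cong)
    fix t :: real
    have "(\<integral>\<^sup>+q. K t q \<partial>lborel) =
        (\<integral>\<^sup>+q. ennreal (exp (- q * t)) * indicator {0<..} q \<partial>lborel) * (g t * indicator {0<..} t)"
      unfolding K_def by (rule nn_integral_multc) measurable
    then show "(\<integral>\<^sup>+q. K t q \<partial>lborel) = ennreal (1 / t) * g t * indicator {0<..} t"
      using nn_integral_exp_greaterThan[of t 0] by (cases "t > 0") (simp_all add: mult.assoc)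
  qed
  finally show ?thesis .
qed

lemma laplace_id_exp:
  assumes "q > 0"
  shows "laplace (\<lambda>t. ennreal (t * exp (- t))) q = ennreal (1 / (1 + q) ^ 2)"
proof -
  let ?F = "\<lambda>t. - (t / (1 + q) + 1 / (1 + q) ^ 2) * exp (- (1 + q) * t)"
  have "laplace (\<lambda>t. ennreal (t * exp (- t))) q
      = (\<integral>\<^sup>+t. ennreal (t * exp (- (1 + q) * t)) * indicator {0<..} t \<partial>lborel)"
    unfolding laplace_def
    by (intro nn_integral_cong)
       (auto simp: indicator_def ennreal_mult[symmetric] algebra_simps simp flip: exp_add)
  also have "\<dots> = ennreal (0 - ?F 0)"
  proof (rule nn_integral_FTC_greaterThan[where F = ?F])
    have "1 + q > 0" using assms by simp
    then show "(?F \<longlongrightarrow> 0) at_top"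
      by real_asymp
    show "(?F has_field_derivative t * exp (- (1 + q) * t)) (at t)" for t
    proof -
      have "((\<lambda>t. - (t / c + 1 / c ^ 2) * exp (- c * t)) has_field_derivative t * exp (- c * t)) (at t)"
        if "c > 0" for c :: real
        using that by (auto intro!: derivative_eq_intros simp: field_simps power2_eq_square)
      from this[of "1 + q"] show ?thesis using assms by simp
    qed
  qed auto
  finally show ?thesis by simp
qed

text \<open>In the variable \<open>z = q / (1 + q)\<close> this is \<open>\<integral>\<^sub>0\<^sup>1 z\<^sup>n (1 - z)\<^sup>2 dz\<close>, because
  \<open>1 / (1 + q) = 1 - z\<close>.\<close>
lemma laplace_pairing_eigen_weight_id_exp:
  "laplace_pairing (eigen_weight n) (\<lambda>t. ennreal (t * exp (- t)))
    = ennreal (2 / (real (n + 1) * real (n + 2) * real (n + 3)))"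
proof -
  let ?z = "\<lambda>q::real. q / (1 + q)"
  let ?F = "\<lambda>q. ?z q ^ Suc n / real (Suc n) - 2 * (?z q ^ Suc (n + 1) / real (Suc (n + 1)))
                + ?z q ^ Suc (n + 2) / real (Suc (n + 2))"
  have "laplace_pairing (eigen_weight n) (\<lambda>t. ennreal (t * exp (- t)))
      = (\<integral>\<^sup>+q. ennreal (eigen_weight n q * (1 / (1 + q) ^ 2)) * indicator {0<..} q \<partial>lborel)"
    unfolding laplace_pairing_def
    by (intro nn_integral_cong)
       (auto simp: indicator_def laplace_id_exp ennreal_mult[symmetric] eigen_weight_nonneg)
  also have "\<dots> = ennreal ((1 / real (Suc n) - 2 * (1 / real (Suc (n + 1))) + 1 / real (Suc (n + 2))) - ?F 0)"
  proof (rule nn_integral_FTC_greaterThan[where F = ?F])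
    have z: "(?z \<longlongrightarrow> 1) at_top" by real_asymp
    show "(?F \<longlongrightarrow> 1 / real (Suc n) - 2 * (1 / real (Suc (n + 1))) + 1 / real (Suc (n + 2))) at_top"
      by (rule tendsto_eq_intros z refl | simp del: power_Suc)+
    fix q :: real assume q: "q \<ge> 0"
    have e: "eigen_weight (n + m) q = eigen_weight n q * ?z q ^ m" for m
      by (simp add: eigen_weight_def power_add power_divide mult_ac)
    \<comment> \<open>The square \<open>(1 - z)\<^sup>2\<close>, expanded so that each term has a primitive from
      \<open>has_deriv_ratio_power\<close>.\<close>
    have sq: "1 / (1 + q) ^ 2 = 1 - 2 * ?z q ^ 1 + ?z q ^ 2"
      using q by (simp add: divide_simps power2_eq_square) (simp add: algebra_simps)
    have split: "eigen_weight n q * (1 / (1 + q) ^ 2)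
        = eigen_weight n q - 2 * eigen_weight (n + 1) q + eigen_weight (n + 2) q"
      unfolding e sq by (simp only: ring_distribs mult_1_right mult.left_commute)
    show "(?F has_field_derivative eigen_weight n q * (1 / (1 + q) ^ 2)) (at q)"
      unfolding split by (intro DERIV_add DERIV_diff DERIV_cmult has_deriv_ratio_power q)
    show "0 \<le> eigen_weight n q * (1 / (1 + q) ^ 2)"
      using q by (simp add: eigen_weight_def)
  qed measurable
  also have "(1 / real (Suc n) - 2 * (1 / real (Suc (n + 1))) + 1 / real (Suc (n + 2))) - ?F 0
      = 2 / (real (n + 1) * real (n + 2) * real (n + 3))"
    by (simp add: divide_simps) (simp add: algebra_simps)
  finally show ?thesis .
qed

lemma laplace_pairing_one_funpow:
  "laplace_pairing (\<lambda>_. 1) ((break_op ^^ Suc k) (\<lambda>t. ennreal (t * exp (- t))))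
    = (\<Sum>n. ennreal (2 / (real (n + 1) ^ Suc k * real (n + 2) * real (n + 3))))"
proof -
  let ?h = "\<lambda>t::real. ennreal (t * exp (- t))"
  have "laplace_pairing (\<lambda>_. 1) ((break_op ^^ Suc k) ?h)
      = (\<Sum>n. laplace_pairing (eigen_weight n) ((break_op ^^ k) ?h))"
    by (simp add: laplace_pairing_one_break_op)
  also have "\<dots> = (\<Sum>n. ennreal (2 / (real (n + 1) ^ Suc k * real (n + 2) * real (n + 3))))"
    by (intro suminf_cong)
       (simp add: laplace_pairing_eigen_weight_funpow laplace_pairing_eigen_weight_id_exp
          ennreal_mult[symmetric] mult_ac)
  finally show ?thesis .
qed

section \<open>The series and the zeta values\<close>

text \<open>The clock representation brings in a time integral, Tonelli moves it to the outside, and for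
  fixed \<open>t\<close> the cube is integrated out by \<open>break_op\<close>. The starting function is \<open>s exp (- s)\<close>
  because \<open>r exp (- r t) = (t r) exp (- t r) / t\<close>.\<close>
lemma sum_nn_integral_stick_perm:
  assumes "k \<ge> 1"
  shows "(\<Sum>\<pi> | \<pi> permutes {1..k}.
      \<integral>\<^sup>+w. ennreal (stick_perm k \<pi> w) * indicator (unit_cube k) w \<partial>cube_measure k)
    = (\<Sum>n. ennreal (2 / (real (n + 1) ^ k * real (n + 2) * real (n + 3))))"
proof -
  interpret product_sigma_finite "\<lambda>_::nat. lborel :: real measure" ..
  interpret cube: sigma_finite_measure "cube_measure k"
    by (rule sigma_finite) simp
  interpret pair_sigma_finite "cube_measure k" "lborel :: real measure" ..
  have [measurable]: "stick_rest k \<in> borel_measurable (cube_measure k)"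
    by (rule measurable_stick_rest) simp
  have [measurable]: "(\<lambda>x. stick (fst x) i) \<in> borel_measurable (cube_measure k \<Otimes>\<^sub>M (lborel :: real measure))"
    if "i \<in> {1..k}" for i
    by (rule measurable_compose[OF measurable_fst measurable_stick[OF that]])
  let ?h = "\<lambda>t::real. ennreal (t * exp (- t))"
  let ?P = "\<lambda>w t. \<Prod>i=1..k. 1 - exp (- stick w i * t)"
  define K where "K w t = ennreal (stick_rest k w * exp (- stick_rest k w * t) * ?P w t)
      * indicator {0<..} t * indicator (unit_cube k) w" for w and t :: real
  have "(\<Sum>\<pi> | \<pi> permutes {1..k}.
      \<integral>\<^sup>+w. ennreal (stick_perm k \<pi> w) * indicator (unit_cube k) w \<partial>cube_measure k)
    = (\<integral>\<^sup>+w. (\<Sum>\<pi> | \<pi> permutes {1..k}. ennreal (stick_perm k \<pi> w) * indicator (unit_cube k) w) \<partial>cube_measure k)"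
  proof (rule nn_integral_sum[symmetric])
    fix \<pi> assume "\<pi> \<in> {\<pi>. \<pi> permutes {1..k}}"
    then have [measurable]: "stick_perm k \<pi> \<in> borel_measurable (cube_measure k)"
      using measurable_stick_perm assms by blast
    show "(\<lambda>w. ennreal (stick_perm k \<pi> w) * indicator (unit_cube k) w) \<in> borel_measurable (cube_measure k)"
      by measurable
  qed
  also have "\<dots> = (\<integral>\<^sup>+w. (\<integral>\<^sup>+t. K w t \<partial>lborel) \<partial>cube_measure k)"
  proof (intro nn_integral_cong)
    fix w
    show "(\<Sum>\<pi> | \<pi> permutes {1..k}. ennreal (stick_perm k \<pi> w) * indicator (unit_cube k) w)
        = (\<integral>\<^sup>+t. K w t \<partial>lborel)"
      using sum_stick_perm_eq_nn_integral[OF _ assms, of w]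
      by (cases "w \<in> unit_cube k") (simp_all add: K_def)
  qed
  also have "\<dots> = (\<integral>\<^sup>+t. (\<integral>\<^sup>+w. K w t \<partial>cube_measure k) \<partial>lborel)"
    unfolding K_def by (rule Fubini'[symmetric]) measurable
  also have "\<dots> = (\<integral>\<^sup>+t. ennreal (1 / t) * (break_op ^^ k) ?h t * indicator {0<..} t \<partial>lborel)"
  proof (intro nn_integral_cong)
    fix t :: real
    show "(\<integral>\<^sup>+w. K w t \<partial>cube_measure k)
        = ennreal (1 / t) * (break_op ^^ k) ?h t * indicator {0<..} t"
    proof (cases "t > 0")
      case True
      have "K w t = ennreal (1 / t) *
          (ennreal (?P w t) * ?h (t * stick_rest k w) * indicator (unit_cube k) w)" for w
      proof (cases "w \<in> unit_cube k")
        case w: True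
        have "?P w t \<ge> 0"
          using stick_nonneg[OF w] True by (intro prod_nonneg) auto
        then show ?thesis
          using True w stick_rest_pos[OF w]
          by (simp add: K_def ennreal_mult[symmetric] mult_ac)
      qed (simp add: K_def)
      then have "(\<integral>\<^sup>+w. K w t \<partial>cube_measure k) = ennreal (1 / t) *
          (\<integral>\<^sup>+w. ennreal (?P w t) * ?h (t * stick_rest k w) * indicator (unit_cube k) w \<partial>cube_measure k)"
        by (simp only:) (rule nn_integral_cmult, measurable)
      also have "\<dots> = ennreal (1 / t) * (break_op ^^ k) ?h t"
        using True by (subst nn_integral_sticks_eq_break_op) auto
      finally show ?thesis
        using True by simp
    qed (simp add: K_def)
  qed
  also have "\<dots> = laplace_pairing (\<lambda>_. 1) ((break_op ^^ k) ?h)"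
    by (rule laplace_pairing_one[symmetric]) measurable
  also have "\<dots> = (\<Sum>n. ennreal (2 / (real (n + 1) ^ k * real (n + 2) * real (n + 3))))"
    using laplace_pairing_one_funpow[of "k - 1"] assms by simp
  finally show ?thesis .
qed

lemma zeta_sums:
  assumes "k \<ge> 2"
  shows "(\<lambda>n. 1 / real (Suc n) ^ k) sums zeta (real k)"
proof -
  have eq: "real (Suc n) powr (- real k) = 1 / real (Suc n) ^ k" for n
    by (simp add: powr_minus powr_realpow inverse_eq_divide del: of_nat_Suc)
  have "summable (\<lambda>n. inverse (real (Suc n) ^ k))"
    using inverse_power_summable[OF assms, where ?'a = real] by (subst summable_Suc_iff)
  then show ?thesis
    unfolding zeta_def eq by (simp add: inverse_eq_divide summable_sums del: of_nat_Suc)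
qed

text \<open>With \<open>m = n + 1\<close>, partial fractions give
  \<open>1 / (m\<^bsup>k+1\<^esup> (m + a)) = (1 / m\<^bsup>k+1\<^esup> - 1 / (m\<^sup>k (m + a))) / a\<close>, and the formula solves the resulting
  recursion in \<open>k\<close>.\<close>
lemma sums_inverse_power_shift:
  fixes a s :: real
  assumes "a > 0" and base: "(\<lambda>n. 1 / (real (Suc n) * (real (Suc n) + a))) sums s" and "k \<ge> 1"
  shows "(\<lambda>n. 1 / (real (Suc n) ^ k * (real (Suc n) + a))) sums
    ((-1) ^ (k - 1) / a ^ (k - 1) * s + (\<Sum>j=2..k. (-1) ^ (k - j) / a ^ (Suc k - j) * zeta (real j)))"
  using \<open>k \<ge> 1\<close>
proof (induction k rule: nat_induct_at_least)
  case base
  then show ?case using assms(2) by simp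
next
  case (Suc k)
  let ?S = "\<lambda>k. (-1) ^ (k - 1) / a ^ (k - 1) * s
                 + (\<Sum>j=2..k. (-1) ^ (k - j) / a ^ (Suc k - j) * zeta (real j))"
  have "(\<lambda>n. (1 / real (Suc n) ^ Suc k - 1 / (real (Suc n) ^ k * (real (Suc n) + a))) / a)
      sums ((zeta (real (Suc k)) - ?S k) / a)"
    using Suc by (intro sums_divide sums_diff zeta_sums) auto
  moreover have "(1 / real (Suc n) ^ Suc k - 1 / (real (Suc n) ^ k * (real (Suc n) + a))) / a
      = 1 / (real (Suc n) ^ Suc k * (real (Suc n) + a))" for n
  proof -
    have "(1 / (p * m) - 1 / (p * (m + a))) / a = 1 / (p * m * (m + a))" if "p > 0" "m > 0" for p m :: real
    proof -
      have "m + a \<noteq> 0" using that \<open>a > 0\<close> by simp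
      then show ?thesis using that \<open>a > 0\<close> by (simp add: divide_simps)
    qed
    from this[of "real (Suc n) ^ k" "real (Suc n)"] show ?thesis
      by (simp add: mult_ac del: of_nat_Suc)
  qed
  moreover have "(zeta (real (Suc k)) - ?S k) / a = ?S (Suc k)"
  proof -
    have "(\<Sum>j=2..k. (-1) ^ (Suc k - j) / a ^ (Suc (Suc k) - j) * zeta (real j))
        = - (\<Sum>j=2..k. (-1) ^ (k - j) / a ^ (Suc k - j) * zeta (real j)) / a"
      unfolding sum_divide_distrib sum_negf[symmetric]
      by (intro sum.cong) (auto simp: Suc_diff_le)
    moreover have "(-1) ^ (Suc k - 1) / a ^ (Suc k - 1) * s = - ((-1) ^ (k - 1) / a ^ (k - 1) * s) / a"
      using Suc.hyps by (cases k) auto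
    ultimately show ?thesis
      using Suc.hyps by (simp add: diff_divide_distrib add_divide_distrib)
  qed
  ultimately show ?case by simp
qed

lemma sums_shift_1: "(\<lambda>n. 1 / (real (Suc n) * (real (Suc n) + 1))) sums 1"
proof -
  let ?f = "\<lambda>n. - (1 / (real n + 1))"
  have "?f \<longlonglongrightarrow> 0" by real_asymp
  from telescope_sums[OF this] have "(\<lambda>n. ?f (Suc n) - ?f n) sums 1"
    by simp
  moreover have "?f (Suc n) - ?f n = 1 / (real (Suc n) * (real (Suc n) + 1))" for n
    by (simp add: divide_simps)
  ultimately show ?thesis by simp
qed

lemma sums_shift_2: "(\<lambda>n. 1 / (real (Suc n) * (real (Suc n) + 2))) sums (3 / 4)"
proof -
  let ?f = "\<lambda>n. - (1 / (real n + 1) + 1 / (real n + 2)) / 2"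
  have "?f \<longlonglongrightarrow> 0" by real_asymp
  from telescope_sums[OF this] have "(\<lambda>n. ?f (Suc n) - ?f n) sums (3 / 4)"
    by simp
  moreover have "?f (Suc n) - ?f n = 1 / (real (Suc n) * (real (Suc n) + 2))" for n
    by (simp add: divide_simps) (simp add: algebra_simps)
  ultimately show ?thesis by simp
qed

lemma sums_zeta_combination:
  assumes "k \<ge> 1"
  shows "(\<lambda>n. 2 / (real (n + 1) ^ k * real (n + 2) * real (n + 3))) sums
    ((-1) ^ (k - 1) * (2 - 3 / 2 ^ k)
      + (\<Sum>j=2..k. (-1) ^ (k - j) * (2 - 1 / 2 ^ (k - j)) * zeta (real j)))"
proof -
  let ?S = "\<lambda>a s. (-1) ^ (k - 1) / a ^ (k - 1) * s
                  + (\<Sum>j=2..k. (-1) ^ (k - j) / a ^ (Suc k - j) * zeta (real j))"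
  have "(\<lambda>n. 2 * (1 / (real (Suc n) ^ k * (real (Suc n) + 1)) - 1 / (real (Suc n) ^ k * (real (Suc n) + 2))))
      sums (2 * (?S 1 1 - ?S 2 (3 / 4)))"
    using assms
    by (intro sums_mult sums_diff sums_inverse_power_shift sums_shift_1 sums_shift_2) auto
  moreover have "2 * (1 / (real (Suc n) ^ k * (real (Suc n) + 1)) - 1 / (real (Suc n) ^ k * (real (Suc n) + 2)))
      = 2 / (real (n + 1) ^ k * real (n + 2) * real (n + 3))" for n
  proof -
    have "2 * (1 / (p * (m + 1)) - 1 / (p * (m + 2))) = 2 / (p * (m + 1) * (m + 2))"
      if "p > 0" "m > 0" for p m :: real
      using that by (simp add: divide_simps)
    from this[of "real (Suc n) ^ k" "real (Suc n)"] show ?thesis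
      by (simp add: add_ac)
  qed
  moreover have "2 * (?S 1 1 - ?S 2 (3 / 4)) = (-1) ^ (k - 1) * (2 - 3 / 2 ^ k)
      + (\<Sum>j=2..k. (-1) ^ (k - j) * (2 - 1 / 2 ^ (k - j)) * zeta (real j))"
  proof -
    have "2 * ((\<Sum>j=2..k. (-1) ^ (k - j) / 1 ^ (Suc k - j) * zeta (real j))
             - (\<Sum>j=2..k. (-1) ^ (k - j) / 2 ^ (Suc k - j) * zeta (real j)))
        = (\<Sum>j=2..k. (-1) ^ (k - j) * (2 - 1 / 2 ^ (k - j)) * zeta (real j))"
      unfolding sum_subtractf[symmetric] sum_distrib_left
      by (intro sum.cong) (auto simp: Suc_diff_le algebra_simps)
    moreover have "2 * ((-1) ^ (k - 1) - (-1) ^ (k - 1) / 2 ^ (k - 1) * (3 / 4))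
        = (-1) ^ (k - 1) * (2 - 3 / 2 ^ k :: real)"
      using assms by (cases k) (auto simp: algebra_simps)
    ultimately show ?thesis
      by (simp add: algebra_simps)
  qed
  ultimately show ?thesis by simp
qed

theorem corollary1p2:
  fixes k :: nat
  assumes "k \<ge> 1"
  defines "E \<equiv> (\<Sum>\<pi> | \<pi> permutes {1..k}.
             LINT w:unit_cube k|cube_measure k. stick_perm k \<pi> w)"
  shows "(\<forall>\<pi>. \<pi> permutes {1..k} \<longrightarrow>
            set_integrable (cube_measure k) (unit_cube k) (stick_perm k \<pi>))
       \<and> E = (-1) ^ (k - 1) * (2 - 3 / 2 ^ k)
             + (\<Sum>j=2..k. (-1) ^ (k - j) * (2 - 1 / 2 ^ (k - j)) * zeta (real j))
       \<and> (\<lambda>n. let j = real (Suc n) in 2 / (j ^ k * (j + 1) * (j + 2))) sums E"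
proof -
  let ?c = "\<lambda>n. 2 / (real (n + 1) ^ k * real (n + 2) * real (n + 3))"
  let ?Z = "(-1) ^ (k - 1) * (2 - 3 / 2 ^ k)
             + (\<Sum>j=2..k. (-1) ^ (k - j) * (2 - 1 / 2 ^ (k - j)) * zeta (real j))"
  let ?f = "\<lambda>\<pi> w. indicator (unit_cube k) w *\<^sub>R stick_perm k \<pi> w"
  let ?N = "\<lambda>\<pi>. \<integral>\<^sup>+w. ennreal (?f \<pi> w) \<partial>cube_measure k"
  have c_sums: "?c sums ?Z"
    by (rule sums_zeta_combination[OF \<open>k \<ge> 1\<close>])
  have Z_nonneg: "?Z \<ge> 0"
    using sums_le[OF _ sums_zero c_sums] by simp
  have f_nonneg: "?f \<pi> w \<ge> 0" if "\<pi> permutes {1..k}" for \<pi> w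
    using stick_perm_nonneg[OF _ that \<open>k \<ge> 1\<close>] by (simp add: indicator_def)
  have f_meas: "?f \<pi> \<in> borel_measurable (cube_measure k)" if "\<pi> permutes {1..k}" for \<pi>
    using measurable_stick_perm[OF that \<open>k \<ge> 1\<close>] by measurable
  have "?N \<pi> = (\<integral>\<^sup>+w. ennreal (stick_perm k \<pi> w) * indicator (unit_cube k) w \<partial>cube_measure k)" for \<pi>
    by (intro nn_integral_cong) (simp add: indicator_def)
  then have "(\<Sum>\<pi> | \<pi> permutes {1..k}. ?N \<pi>) = (\<Sum>n. ennreal (?c n))"
    by (simp only: sum_nn_integral_stick_perm[OF \<open>k \<ge> 1\<close>])
  also have "\<dots> = ennreal ?Z"
    using c_sums Z_nonneg by (intro sums_unique[symmetric] sums_ennreal[THEN iffD2]) auto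
  finally have sum_N: "(\<Sum>\<pi> | \<pi> permutes {1..k}. ?N \<pi>) = ennreal ?Z" .
  have fin: "finite {\<pi>. \<pi> permutes {1..k}}"
    by (simp add: finite_permutations)
  have N_finite: "?N \<pi> < \<infinity>" if "\<pi> permutes {1..k}" for \<pi>
  proof -
    have "?N \<pi> \<le> (\<Sum>\<pi> | \<pi> permutes {1..k}. ?N \<pi>)"
      using that fin by (intro member_le_sum) auto
    then show ?thesis
      unfolding sum_N by (simp add: le_less_trans)
  qed
  have integrable: "integrable (cube_measure k) (?f \<pi>)" if "\<pi> permutes {1..k}" for \<pi>
    using f_meas[OF that] f_nonneg[OF that] N_finite[OF that] by (intro integrableI_nonneg) auto
  have "ennreal E = (\<Sum>\<pi> | \<pi> permutes {1..k}. ennreal (LINT w:unit_cube k|cube_measure k. stick_perm k \<pi> w))"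
    unfolding E_def using f_nonneg
    by (intro sum_ennreal[symmetric]) (auto simp: set_lebesgue_integral_def intro!: integral_nonneg)
  also have "\<dots> = (\<Sum>\<pi> | \<pi> permutes {1..k}. ?N \<pi>)"
    unfolding set_lebesgue_integral_def using integrable f_nonneg
    by (intro sum.cong nn_integral_eq_integral[symmetric]) auto
  finally have "ennreal E = ennreal ?Z"
    unfolding sum_N .
  moreover have "E \<ge> 0"
    unfolding E_def set_lebesgue_integral_def using f_nonneg
    by (intro sum_nonneg integral_nonneg) auto
  ultimately have E: "E = ?Z"
    using Z_nonneg by simp
  moreover have "(\<lambda>n. let j = real (Suc n) in 2 / (j ^ k * (j + 1) * (j + 2))) = ?c"
    by (simp add: fun_eq_iff Let_def add_ac)
  ultimately show ?thesis
    using integrable c_sums unfolding set_integrable_def by simp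
qed

end
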